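(* Let $\mathscr L$ be a lattice (bounded, distributive, with $0\neq 1$). Suppose there exist a cover $\mathscr U$ of $\mathscr L$ and an automorphism $\lambda\colon\mathscr L\to\mathscr L$ such that $\lambda$ is expansive and the cover $\mathscr U^2=\{u_1\sqcup u_2: u_1,u_2\in\mathscr U,\ u_1\sqcap u_2\neq 0\}$ is an expansivity cover for $\lambda$. Then $\dim\mathscr L$ is finite.
   Context: Throughout, "lattice" means a bounded distributive lattice $\mathscr L$ (partially ordered by $\leq$, with binary join $\sqcup$, meet $\sqcap$, minimum $0$ and maximum $1$) such that $0\neq 1$. For finite $\mathscr C\subseteq\mathscr L$, $\bigsqcup\mathscr C$ and $\mathop{\sqcap}\mathscr C$ denote its least upper bound and greatest lower bound (so $\bigsqcup\varnothing=0$, $\mathop{\sqcap}\varnothing=1$). $\mathbb N=\{0,1,2,\dots\}$. A cover of $\mathscr L$ is a finite subset $\mathscr U\subseteq\mathscr L$ with $\bigsqcup\mathscr U=1$; $\mathscr C(\mathscr L)$ is the set of all covers. For $\mathscr U,\mathscr V\subseteq\mathscr L$: $\mathscr U\prec\mathscr V$ means that for every $u\in\mathscr U$ there is $v\in\mathscr V$ with $u\leq v$; and $\mathscr U\wedge\mathscr V=\{u\sqcap v:u\in\mathscr U,v\in\mathscr V\}$ (an associative and commutative operation; $\bigwedge$ denotes its iteration over a finite nonempty index set). An automorphism of $\mathscr L$ is a bijection $\lambda\colon\mathscr L\to\mathscr L$ preserving $\sqcup$ and $\sqcap$; $\lambda\mathscr U=\{\lambda u:u\in\mathscr U\}$, and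 $\lambda^n$ ($n\in\mathbb Z$) denotes the iterates of $\lambda$. An automorphism $\lambda$ is expansive if there is a cover $\mathscr U\in\mathscr C(\mathscr L)$ such that for every $\mathscr V\in\mathscr C(\mathscr L)$ there exists $N\in\mathbb N$ with $\bigwedge_{|n|\leq N}\lambda^n\mathscr U\prec\mathscr V$; any such $\mathscr U$ is called an expansivity cover for $\lambda$. The order of a cover $\mathscr U$ is $\operatorname{ord}\mathscr U=\max\{n\in\mathbb N:\exists\,\mathscr V\subseteq\mathscr U\text{ with }|\mathscr V|=n\text{ and }\mathop{\sqcap}\mathscr V\neq 0\}$. The dimension of $\mathscr L$ is $\dim\mathscr L=\min\{n\in\mathbb N:\forall\,\mathscr U\in\mathscr C(\mathscr L)\ \exists\,\mathscr V\in\mathscr C(\mathscr L)\text{ with }\mathscr V\prec\mathscr U\text{ and }\operatorname{ord}\mathscr V\leq n+1\}$ if this set is nonempty, and $\dim\mathscr L=\infty$ otherwise. *)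

theory Defs
  imports Main "HOL-Library.Extended_Nat"
begin

text \<open>
  A bounded distributive lattice is a type of sort \<open>{distrib_lattice, bounded_lattice}\<close>, with
  \<^const>\<open>bot\<close> and \<^const>\<open>top\<close> as 0 and 1; the condition that these differ is not part of the
  sort and is a hypothesis where it is needed.
\<close>

global_interpretation fin_join: semilattice_order_neutr_set
    sup "bot :: 'a :: {distrib_lattice, bounded_lattice}" greater_eq greater
  defines fin_join = fin_join.F
  by standard (auto simp: less_le_not_le sup.order_iff)

global_interpretation fin_meet: semilattice_order_neutr_set
    inf "top :: 'a :: {distrib_lattice, bounded_lattice}" less_eq less
  defines fin_meet = fin_meet.F
  by standard

lemma fin_join_least_upper_bound:
  fixes C :: "'a :: {distrib_lattice, bounded_lattice} set"
  assumes "finite C"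
  shows "\<forall>c\<in>C. c \<le> fin_join C" and "(\<forall>c\<in>C. c \<le> x) \<Longrightarrow> fin_join C \<le> x"
  using assms by (auto intro: fin_join.coboundedI fin_join.boundedI)

lemma fin_meet_greatest_lower_bound:
  fixes C :: "'a :: {distrib_lattice, bounded_lattice} set"
  assumes "finite C"
  shows "\<forall>c\<in>C. fin_meet C \<le> c" and "(\<forall>c\<in>C. x \<le> c) \<Longrightarrow> x \<le> fin_meet C"
  using assms by (auto intro: fin_meet.coboundedI fin_meet.boundedI)

definition covers :: "'a :: {distrib_lattice, bounded_lattice} set set" where
  "covers = {U. finite U \<and> fin_join U = top}"

definition refines :: "'a :: {distrib_lattice, bounded_lattice} set \<Rightarrow> 'a set \<Rightarrow> bool"
    (infix \<open>\<prec>\<close> 50) where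
  "U \<prec> V \<longleftrightarrow> (\<forall>u\<in>U. \<exists>v\<in>V. u \<le> v)"

definition wedge :: "'a :: {distrib_lattice, bounded_lattice} set \<Rightarrow> 'a set \<Rightarrow> 'a set" where
  "wedge U V = {inf u v | u v. u \<in> U \<and> v \<in> V}"

text \<open>
  Iteration of \<open>wedge\<close> over a finite index set. The neutral element \<open>{top}\<close> only supplies the
  value at the empty index set.
\<close>

global_interpretation big_wedge: comm_monoid_set
    wedge "{top :: 'a :: {distrib_lattice, bounded_lattice}}"
  defines big_wedge = big_wedge.F
proof
  fix A B C :: "'a set"
  show "wedge (wedge A B) C = wedge A (wedge B C)"
    unfolding wedge_def by (auto; metis inf.assoc)
  show "wedge A B = wedge B A"
    unfolding wedge_def by (auto; metis inf.commute)
  show "wedge A {top} = A"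
    unfolding wedge_def by auto
qed

definition automorphism :: "('a :: {distrib_lattice, bounded_lattice} \<Rightarrow> 'a) \<Rightarrow> bool" where
  "automorphism f \<longleftrightarrow>
     bij f \<and> (\<forall>x y. f (sup x y) = sup (f x) (f y)) \<and> (\<forall>x y. f (inf x y) = inf (f x) (f y))"

text \<open>Integer iterates; meaningful for bijections.\<close>

definition int_iterate :: "('a \<Rightarrow> 'a) \<Rightarrow> int \<Rightarrow> 'a \<Rightarrow> 'a" where
  "int_iterate f n = (if 0 \<le> n then f ^^ nat n else (inv f) ^^ nat (- n))"

definition expansivity_cover ::
    "('a :: {distrib_lattice, bounded_lattice} \<Rightarrow> 'a) \<Rightarrow> 'a set \<Rightarrow> bool" where
  "expansivity_cover f U \<longleftrightarrow>
     U \<in> covers \<and>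
     (\<forall>V\<in>covers. \<exists>N::nat. big_wedge (\<lambda>n. int_iterate f n ` U) {n::int. \<bar>n\<bar> \<le> int N} \<prec> V)"

definition expansive :: "('a :: {distrib_lattice, bounded_lattice} \<Rightarrow> 'a) \<Rightarrow> bool" where
  "expansive f \<longleftrightarrow> automorphism f \<and> (\<exists>U. expansivity_cover f U)"

definition cover_square :: "'a :: {distrib_lattice, bounded_lattice} set \<Rightarrow> 'a set" where
  "cover_square U = {sup u v | u v. u \<in> U \<and> v \<in> U \<and> inf u v \<noteq> bot}"

definition cover_order :: "'a :: {distrib_lattice, bounded_lattice} set \<Rightarrow> nat" where
  "cover_order U = Max {n. \<exists>V \<subseteq> U. card V = n \<and> fin_meet V \<noteq> bot}"

text \<open>The maximum exists for covers, since 0 differs from 1.\<close>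

lemma cover_order_set_finite_nonempty:
  fixes U :: "'a :: {distrib_lattice, bounded_lattice} set"
  assumes "(bot :: 'a) \<noteq> top" and "U \<in> covers"
  shows "finite {n. \<exists>V \<subseteq> U. card V = n \<and> fin_meet V \<noteq> bot}"
    and "{n. \<exists>V \<subseteq> U. card V = n \<and> fin_meet V \<noteq> bot} \<noteq> {}"
proof -
  have "finite U"
    using assms(2) by (simp add: covers_def)
  then have "{n. \<exists>V \<subseteq> U. card V = n \<and> fin_meet V \<noteq> bot} \<subseteq> {..card U}"
    by (auto intro: card_mono)
  then show "finite {n. \<exists>V \<subseteq> U. card V = n \<and> fin_meet V \<noteq> bot}"
    by (rule finite_subset) simp
  show "{n. \<exists>V \<subseteq> U. card V = n \<and> fin_meet V \<noteq> bot} \<noteq> {}"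
    using assms(1) fin_meet.empty by (metis (mono_tags, lifting) empty_Collect_eq empty_subsetI)
qed

definition dim_le :: "'a :: {distrib_lattice, bounded_lattice} itself \<Rightarrow> nat \<Rightarrow> bool" where
  "dim_le T n \<longleftrightarrow>
     (\<forall>U \<in> (covers :: 'a set set). \<exists>V \<in> covers. V \<prec> U \<and> cover_order V \<le> n + 1)"

definition lattice_dim :: "'a :: {distrib_lattice, bounded_lattice} itself \<Rightarrow> enat" where
  "lattice_dim T = (if \<exists>n. dim_le T n then enat (LEAST n. dim_le T n) else \<infinity>)"

end

(*
  This is Mane's argument for expansive homeomorphisms.  Choose N such that the wedge of the
  f^k U^2 over |k| <= N refines U, and consider the cells of the wedge of the f^k U over |k| <= n.
  Group the cells by the elements of U that contain them at the times n - N < |k| <= n.  Whenever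
  two elements meet and both lie in some f^k u for every |k| <= n, their join lies in an element of
  f^k U^2 for every |k| <= n, hence, by the choice of N, in an element of f^k U for |k| <= n - N;
  for the remaining k it does so by the grouping.  So within a group meeting cells can be joined
  until the results are pairwise disjoint, without leaving the refinement of f^k U.  The order of
  the resulting cover is at most the number of groups, which is bounded independently of n.
*)
theory Submission
  imports Defs "HOL-Library.FuncSet"
begin

section \<open>Covers and their wedges\<close>

text \<open>Being below \<open>inf u v\<close> means being below both \<open>u\<close> and
  \<open>v\<close>, so refinement of an iterated wedge can be tested factor by factor.\<close>

lemma le_big_wedge_iff:
  fixes x :: "'a :: {distrib_lattice, bounded_lattice}"
  assumes "finite A"
  shows "(\<exists>c\<in>big_wedge g A. x \<le> c) \<longleftrightarrow> (\<forall>a\<in>A. \<exists>c\<in>g a. x \<le> c)"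
  using assms
proof induction
  case (insert a A)
  have "(\<exists>c\<in>wedge S T. x \<le> c) \<longleftrightarrow> (\<exists>c\<in>S. x \<le> c) \<and> (\<exists>c\<in>T. x \<le> c)" for S T
    unfolding wedge_def by (fastforce intro: le_infI)
  then show ?case
    using insert by simp
qed simp

lemma inf_fin_join:
  fixes x :: "'a :: {distrib_lattice, bounded_lattice}"
  assumes "finite A"
  shows "inf x (fin_join A) = fin_join (inf x ` A)"
  using assms by induction (simp_all add: inf_sup_distrib1)

lemma inf_fin_join_eq_bot_iff:
  fixes x :: "'a :: {distrib_lattice, bounded_lattice}"
  assumes "finite A"
  shows "inf x (fin_join A) = bot \<longleftrightarrow> (\<forall>a\<in>A. inf x a = bot)"
  using assms by induction (simp_all add: inf_sup_distrib1)

lemma wedge_covers: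
  assumes "U \<in> covers" "V \<in> covers"
  shows "wedge U V \<in> covers"
proof -
  have fin: "finite U" "finite V" and top: "fin_join U = top" "fin_join V = top"
    using assms by (auto simp: covers_def)
  have W: "wedge U V = (\<lambda>(u, v). inf u v) ` (U \<times> V)"
    by (auto simp: wedge_def)
  then have finW: "finite (wedge U V)"
    using fin by simp
  have "u \<le> fin_join (wedge U V)" if "u \<in> U" for u
  proof -
    \<comment> \<open>Since \<open>V\<close> joins to \<open>top\<close>, distributivity splits
      \<open>u\<close> into its meets with the members of \<open>V\<close>.\<close>
    have "u = fin_join (inf u ` V)"
      using inf_fin_join[OF fin(2), of u] top by simp
    also have "\<dots> \<le> fin_join (wedge U V)"
      using finW that fin by (intro fin_join_least_upper_bound(2))
        (auto simp: wedge_def intro!: fin_join.coboundedI)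
    finally show ?thesis .
  qed
  then have "top \<le> fin_join (wedge U V)"
    using fin_join_least_upper_bound(2)[OF fin(1)] top by metis
  then show ?thesis
    using finW by (simp add: covers_def top_unique)
qed

lemma big_wedge_covers:
  assumes "finite A" "\<And>a. a \<in> A \<Longrightarrow> g a \<in> covers"
  shows "big_wedge g A \<in> covers"
  using assms by induction (simp_all add: wedge_covers, simp add: covers_def)

section \<open>Integer iterates and automorphisms\<close>

lemma int_iterate_0 [simp]: "int_iterate f 0 = id"
  by (simp add: int_iterate_def)

lemma int_iterate_Suc:
  assumes "bij f"
  shows "int_iterate f (i + 1) x = f (int_iterate f i x)"
proof (cases "0 \<le> i")
  case True
  then have "nat (i + 1) = Suc (nat i)"
    by simp
  with True show ?thesis
    by (simp add: int_iterate_def)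
next
  case False
  then have "nat (- i) = Suc (nat (- (i + 1)))"
    by simp
  moreover have "f (inv f y) = y" for y
    using assms by (simp add: bij_is_surj surj_f_inv_f)
  \<comment> \<open>At \<open>i = -1\<close> the successor index 0 already falls into the other
    branch of \<open>int_iterate\<close>.\<close>
  ultimately show ?thesis
    using False by (cases "i = -1") (simp_all add: int_iterate_def)
qed

text \<open>Induction in both directions from 0; the downward step applies \<open>f\<close> to both
  sides and cancels it by injectivity.\<close>

lemma int_iterate_add:
  assumes "bij f"
  shows "int_iterate f (i + j) x = int_iterate f i (int_iterate f j x)"
proof (induction i rule: int_induct[where k = 0])
  case base
  show ?case by simp
next
  case (step1 i)
  then show ?case
    using int_iterate_Suc[OF assms] by (metis add.assoc add.commute)
next
  case (step2 i)
  have "f (int_iterate f (i - 1 + j) x) = int_iterate f (i + j) x"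
    using int_iterate_Suc[OF assms, of "i - 1 + j" x] by (simp add: algebra_simps)
  also have "\<dots> = f (int_iterate f (i - 1) (int_iterate f j x))"
    using step2 int_iterate_Suc[OF assms, of "i - 1"] by simp
  finally show ?case
    using assms by (simp add: bij_is_inj inj_eq)
qed

lemma automorphism_funpow:
  assumes "automorphism f"
  shows "automorphism (f ^^ n)"
  using assms by (induction n) (auto simp: automorphism_def intro: bij_comp)

lemma automorphism_inv:
  assumes "automorphism f"
  shows "automorphism (inv f)"
proof -
  have b: "bij f"
    using assms by (simp add: automorphism_def)
  have "inv f (sup x y) = sup (inv f x) (inv f y) \<and> inv f (inf x y) = inf (inv f x) (inv f y)"
    for x y
  proof -
    obtain x' y' where xy: "x = f x'" "y = f y'"
      using b by (metis bij_pointE)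
    have "sup x y = f (sup x' y')" "inf x y = f (inf x' y')"
      using assms xy by (simp_all add: automorphism_def)
    then show ?thesis
      using xy b by (simp add: bij_is_inj)
  qed
  then show ?thesis
    using b by (simp add: automorphism_def bij_imp_bij_inv)
qed

lemma automorphism_int_iterate:
  "automorphism f \<Longrightarrow> automorphism (int_iterate f k)"
  by (simp add: int_iterate_def automorphism_funpow automorphism_inv)

lemma automorphism_le_iff:
  assumes "automorphism f"
  shows "f x \<le> f y \<longleftrightarrow> x \<le> y"
  using assms by (metis automorphism_def bij_is_inj inj_eq le_iff_inf)

text \<open>By surjectivity \<open>bot\<close> is some \<open>f y\<close>, and
  \<open>bot \<le> y\<close> gives \<open>f bot \<le> f y\<close>.\<close>

lemma automorphism_bot:
  assumes "automorphism f"
  shows "f bot = bot"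
  using automorphism_le_iff[OF assms] assms
  by (metis automorphism_def bij_pointE bot.extremum bot.extremum_uniqueI)

lemma automorphism_top:
  assumes "automorphism f"
  shows "f top = top"
  using automorphism_le_iff[OF assms] assms
  by (metis automorphism_def bij_pointE top.extremum top.extremum_uniqueI)

lemma automorphism_fin_join:
  assumes "automorphism f" "finite A"
  shows "f (fin_join A) = fin_join (f ` A)"
  using assms(2,1) by induction (simp_all add: automorphism_bot, simp add: automorphism_def)

lemma automorphism_image_covers:
  "automorphism f \<Longrightarrow> U \<in> covers \<Longrightarrow> f ` U \<in> covers"
  by (auto simp: covers_def automorphism_top simp flip: automorphism_fin_join)

text \<open>Expansivity stated for a single element \<open>x\<close>. This form applies directly to
  joins of cells, which need not belong to the wedge.\<close>

lemma expansivity_coverD: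
  assumes "expansivity_cover f U" "V \<in> covers"
  obtains N :: nat where
    "\<And>x. (\<And>k. \<bar>k\<bar> \<le> int N \<Longrightarrow> \<exists>u\<in>U. x \<le> int_iterate f k u) \<Longrightarrow> \<exists>v\<in>V. x \<le> v"
proof -
  obtain N :: nat where N: "big_wedge (\<lambda>n. int_iterate f n ` U) {n. \<bar>n\<bar> \<le> int N} \<prec> V"
    using assms by (auto simp: expansivity_cover_def)
  have fin: "finite {n. \<bar>n\<bar> \<le> int N}"
    by (rule finite_subset[of _ "{- int N..int N}"]) auto
  show thesis
  proof
    fix x
    assume "\<exists>u\<in>U. x \<le> int_iterate f k u" if "\<bar>k\<bar> \<le> int N" for k
    then have "\<exists>c\<in>big_wedge (\<lambda>n. int_iterate f n ` U) {n. \<bar>n\<bar> \<le> int N}. x \<le> c"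
      by (subst le_big_wedge_iff[OF fin]) auto
    then show "\<exists>v\<in>V. x \<le> v"
      using N by (meson order_trans refines_def)
  qed
qed

section \<open>Disjoint families and the order of a cover\<close>

text \<open>A maximal subfamily \<open>T\<close> whose join satisfies \<open>P\<close> has a join
  disjoint from every remaining member, since a member meeting it could be added. Split
  \<open>T\<close> off and recurse on \<open>S - T\<close>.\<close>

lemma disjoint_joins:
  fixes S :: "'a :: {distrib_lattice, bounded_lattice} set"
  assumes "finite S" "\<And>s. s \<in> S \<Longrightarrow> P s"
    and "\<And>d s. P d \<Longrightarrow> s \<in> S \<Longrightarrow> inf d s \<noteq> bot \<Longrightarrow> P (sup d s)"
  obtains D where "finite D" "\<And>d. d \<in> D \<Longrightarrow> P d" "fin_join D = fin_join S"
    "pairwise (\<lambda>d e. inf d e = bot) D"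
proof -
  have "\<exists>D. finite D \<and> (\<forall>d\<in>D. P d) \<and> fin_join D = fin_join S
    \<and> pairwise (\<lambda>d e. inf d e = bot) D"
    using assms
  proof (induction "card S" arbitrary: S rule: less_induct)
    case less
    show ?case
    proof (cases "S = {}")
      case True
      then show ?thesis
        by (intro exI[of _ "{}"]) auto
    next
      case False
      then obtain s where s: "s \<in> S"
        by auto
      \<comment> \<open>Nonemptiness of \<open>T\<close> makes \<open>S - T\<close> strictly
        smaller, as the induction requires.\<close>
      let ?F = "{T. T \<subseteq> S \<and> T \<noteq> {} \<and> P (fin_join T)}"
      have "finite ?F"
        using less.prems(1) by simp
      moreover have "?F \<noteq> {}"
        using s less.prems(2) by (auto intro!: exI[of _ "{s}"])
      ultimately obtain T where T: "T \<in> ?F" and max: "\<forall>T'\<in>?F. T \<subseteq> T' \<longrightarrow> T = T'"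
        by (rule finite_has_maximal[THEN bexE])
      have finT: "finite T"
        using T less.prems(1) finite_subset by auto
      have disj: "inf (fin_join T) s' = bot" if s': "s' \<in> S - T" for s'
      proof (rule ccontr)
        assume "inf (fin_join T) s' \<noteq> bot"
        then have "P (sup (fin_join T) s')"
          using less.prems(3) T s' by simp
        then have "P (fin_join (insert s' T))"
          using s' finT by (simp add: sup.commute)
        then have "insert s' T \<in> ?F"
          using T s' by auto
        then show False
          using max s' by blast
      qed
      have "card (S - T) < card S"
        using T less.prems(1) by (intro psubset_card_mono) auto
      then obtain D where D: "finite D" "\<forall>d\<in>D. P d" "fin_join D = fin_join (S - T)"
        "pairwise (\<lambda>d e. inf d e = bot) D"
        using less.hyps[of "S - T"] less.prems by auto
      \<comment> \<open>Members of \<open>D\<close> need not lie in \<open>S - T\<close>, so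
        disjointness is transferred through the common join.\<close>
      have "inf (fin_join T) (fin_join D) = bot"
        using disj inf_fin_join_eq_bot_iff[of "S - T"] less.prems(1) D(3) by simp
      then have *: "inf (fin_join T) d = bot" if "d \<in> D" for d
        using that D(1) by (simp add: inf_fin_join_eq_bot_iff)
      have "fin_join (insert (fin_join T) D) = fin_join (T \<union> (S - T))"
        using D(1,3) finT less.prems(1) by (simp add: fin_join.union del: Un_Diff_cancel)
      also have "T \<union> (S - T) = S"
        using T by auto
      finally show ?thesis
        using D T * by (intro exI[of _ "insert (fin_join T) D"])
          (auto simp: pairwise_insert inf.commute)
    qed
  qed
  then show thesis
    using that by auto
qed

text \<open>A subfamily with nonzero meet contains at most one member of each pairwise disjoint
  family \<open>D t\<close>.\<close>

lemma cover_order_UN_le: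
  fixes D :: "'b \<Rightarrow> 'a :: {distrib_lattice, bounded_lattice} set"
  assumes "(bot :: 'a) \<noteq> top" "finite I" "(\<Union>t\<in>I. D t) \<in> covers"
    and "\<And>t. t \<in> I \<Longrightarrow> pairwise (\<lambda>d e. inf d e = bot) (D t)"
  shows "cover_order (\<Union>t\<in>I. D t) \<le> card I"
proof -
  have "card V \<le> card I" if V: "V \<subseteq> (\<Union>t\<in>I. D t)" "fin_meet V \<noteq> bot" for V
  proof -
    have finV: "finite V"
      using V(1) assms(3) finite_subset by (auto simp: covers_def)
    have "card (V \<inter> D t) \<le> 1" if "t \<in> I" for t
    proof -
      have "d = e" if "d \<in> V \<inter> D t" "e \<in> V \<inter> D t" for d e
      proof (rule ccontr)
        assume "d \<noteq> e"
        then have "inf d e = bot"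
          using that assms(4)[OF \<open>t \<in> I\<close>] by (auto simp: pairwise_def)
        moreover have "fin_meet V \<le> inf d e"
          using that fin_meet_greatest_lower_bound(1)[OF finV] by simp
        ultimately show False
          using V(2) by (simp add: bot_unique)
      qed
      then show ?thesis
        using finV card_le_Suc0_iff_eq[of "V \<inter> D t"] by auto
    qed
    then have "(\<Sum>t\<in>I. card (V \<inter> D t)) \<le> card I"
      using sum_mono[of I "\<lambda>t. card (V \<inter> D t)" "\<lambda>_. 1"] by simp
    moreover have "V = (\<Union>t\<in>I. V \<inter> D t)"
      using V(1) by auto
    ultimately show ?thesis
      using card_UN_le[OF assms(2), of "\<lambda>t. V \<inter> D t"] by simp
  qed
  then show ?thesis
    unfolding cover_order_def
    using cover_order_set_finite_nonempty[OF assms(1,3)] by (subst Max_le_iff) auto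
qed

section \<open>Joining cells by means of expansivity\<close>

text \<open>A nonzero \<open>u\<close> equals \<open>sup u u\<close>, a member of the square;
  \<open>bot\<close> lies below any member, whence the nonemptiness assumption.\<close>

lemma cover_square_superset:
  fixes U :: "'a :: {distrib_lattice, bounded_lattice} set"
  assumes "u \<in> U" "cover_square U \<noteq> {}"
  shows "\<exists>v\<in>cover_square U. u \<le> v"
proof (cases "u = bot")
  case True
  then show ?thesis
    using assms(2) by auto
next
  case False
  then have "sup u u \<in> cover_square U"
    using assms(1) unfolding cover_square_def by fastforce
  then show ?thesis
    by auto
qed

text \<open>The window shrinks by \<open>N\<close> because \<open>N\<close> must be applied around
  time \<open>k\<close>, which uses the data on \<open>d\<close> and \<open>e\<close> at all times
  \<open>k + j\<close> with \<open>j\<close> between \<open>-N\<close> and \<open>N\<close>.\<close>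

lemma join_le_iterate:
  fixes N :: nat
  assumes f: "automorphism f"
    and N: "\<And>x. (\<And>k. \<bar>k\<bar> \<le> int N \<Longrightarrow> \<exists>v\<in>cover_square U. x \<le> int_iterate f k v)
      \<Longrightarrow> \<exists>u\<in>U. x \<le> u"
    and d: "\<And>k. \<bar>k\<bar> \<le> n \<Longrightarrow> \<exists>u\<in>U. d \<le> int_iterate f k u"
    and e: "\<And>k. \<bar>k\<bar> \<le> n \<Longrightarrow> \<exists>u\<in>U. e \<le> int_iterate f k u"
    and de: "inf d e \<noteq> bot"
    and k: "\<bar>k\<bar> \<le> n - int N"
  shows "\<exists>u\<in>U. sup d e \<le> int_iterate f k u"
proof -
  have bij: "bij f"
    using f by (simp add: automorphism_def)
  have aut: "automorphism (int_iterate f j)" for j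
    by (rule automorphism_int_iterate[OF f])
  \<comment> \<open>Pulling the join back by the \<open>k\<close>-th iterate moves time
    \<open>k\<close> to time 0, where \<open>N\<close> applies.\<close>
  obtain x where x: "sup d e = int_iterate f k x"
    using aut[of k] by (metis automorphism_def bij_pointE)
  have "\<exists>v\<in>cover_square U. x \<le> int_iterate f j v" if "\<bar>j\<bar> \<le> int N" for j
  proof -
    let ?g = "int_iterate f (k + j)"
    have "\<bar>k + j\<bar> \<le> n"
      using that k by linarith
    then obtain u v where uv: "u \<in> U" "v \<in> U" "d \<le> ?g u" "e \<le> ?g v"
      using d e by blast
    \<comment> \<open>This forces \<open>u\<close> and \<open>v\<close> to meet, so that their join
      belongs to the square.\<close>
    have "inf d e \<le> ?g (inf u v)"
      using uv aut[of "k + j"] by (simp add: automorphism_def le_infI1 le_infI2)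
    then have "inf u v \<noteq> bot"
      using de automorphism_bot[OF aut] by (metis bot.extremum_uniqueI)
    then have "sup u v \<in> cover_square U"
      using uv by (auto simp: cover_square_def)
    moreover have "int_iterate f k x \<le> ?g (sup u v)"
      using uv aut[of "k + j"] x
      by (metis automorphism_def sup.mono)
    ultimately show ?thesis
      using automorphism_le_iff[OF aut[of k]] int_iterate_add[OF bij] by auto
  qed
  then obtain u where "u \<in> U" "x \<le> u"
    using N by blast
  then show ?thesis
    using x automorphism_le_iff[OF aut] by auto
qed

text \<open>The bound on the order is independent of \<open>n\<close>; this uniformity yields finite
  dimension.\<close>

lemma bounded_order_cover:
  fixes U :: "'a :: {distrib_lattice, bounded_lattice} set" and N :: nat and n :: int
  assumes bt: "(bot :: 'a) \<noteq> top" and U: "U \<in> covers" and f: "automorphism f"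
    and N: "\<And>x. (\<And>k. \<bar>k\<bar> \<le> int N \<Longrightarrow> \<exists>v\<in>cover_square U. x \<le> int_iterate f k v)
      \<Longrightarrow> \<exists>u\<in>U. x \<le> u"
  obtains V where "V \<in> covers" "cover_order V \<le> card U ^ (2 * N)"
    "\<And>v k. v \<in> V \<Longrightarrow> \<bar>k\<bar> \<le> n \<Longrightarrow> \<exists>u\<in>U. v \<le> int_iterate f k u"
proof -
  have finU: "finite U" and "U \<noteq> {}"
    using U bt by (auto simp: covers_def)
  define C where "C = big_wedge (\<lambda>k. int_iterate f k ` U) {-n..n}"
  have C: "C \<in> covers"
    unfolding C_def
    by (intro big_wedge_covers automorphism_image_covers automorphism_int_iterate f U) simp
  then have finC: "finite C" and joinC: "fin_join C = top"
    by (auto simp: covers_def)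
  have C_le: "\<exists>u\<in>U. c \<le> int_iterate f k u" if "c \<in> C" "\<bar>k\<bar> \<le> n" for c k
  proof -
    have "\<exists>c'\<in>C. c \<le> c'"
      using that by auto
    then have "\<forall>a\<in>{-n..n}. \<exists>u\<in>int_iterate f a ` U. c \<le> u"
      unfolding C_def by (subst (asm) le_big_wedge_iff) simp_all
    moreover have "k \<in> {-n..n}"
      using that(2) by (auto simp: abs_le_iff)
    ultimately show ?thesis
      by blast
  qed
  \<comment> \<open>The boundary times, at most \<open>N\<close> at each end of the window. If
    \<open>N\<close> is large compared with \<open>n\<close>, \<open>B\<close> sticks out of the
    window, hence the intersections with \<open>{-n..n}\<close> below.\<close>
  define B where "B = {n - int N<..n} \<union> {-n..<int N - n}"
  have "card B \<le> 2 * N"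
    unfolding B_def by (rule order_trans[OF card_Un_le]) simp
  \<comment> \<open>A label \<open>t\<close> in \<open>I\<close> picks a member of \<open>U\<close>
    at each boundary time. Extensional functions keep \<open>I\<close> finite.\<close>
  define I where "I = (PiE (B \<inter> {-n..n}) (\<lambda>_. U))"
  have "finite (B \<inter> {-n..n})" "card (B \<inter> {-n..n}) \<le> 2 * N"
    using \<open>card B \<le> 2 * N\<close> card_mono[of B "B \<inter> {-n..n}"] by (auto simp: B_def)
  then have finI: "finite I" and cardI: "card I \<le> card U ^ (2 * N)"
    using finU \<open>U \<noteq> {}\<close>
    by (auto simp: I_def finite_PiE card_PiE card_gt_0_iff Suc_le_eq intro!: power_increasing)
  define S where "S t = {c \<in> C. \<forall>k\<in>B \<inter> {-n..n}. c \<le> int_iterate f k (t k)}" for t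
  \<comment> \<open>The second clause is preserved by all joins and secures the first at boundary
    times; at the other times \<open>join_le_iterate\<close> preserves the first for meeting
    elements.\<close>
  define P where "P t d \<longleftrightarrow> (\<forall>k. \<bar>k\<bar> \<le> n \<longrightarrow> (\<exists>u\<in>U. d \<le> int_iterate f k u))
    \<and> (\<forall>k\<in>B \<inter> {-n..n}. d \<le> int_iterate f k (t k))" for t d
  have PS: "P t c" if "c \<in> S t" for t c
    using that C_le by (simp add: P_def S_def)
  have P_sup: "P t (sup d c)" if "t \<in> I" "P t d" "P t c" "inf d c \<noteq> bot" for t d c
  proof -
    have "\<exists>u\<in>U. sup d c \<le> int_iterate f k u" if k: "\<bar>k\<bar> \<le> n" for k
    proof (cases "\<bar>k\<bar> \<le> n - int N")
      case True
      show ?thesis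
        by (rule join_le_iterate[OF f N _ _ \<open>inf d c \<noteq> bot\<close> True])
          (use \<open>P t d\<close> \<open>P t c\<close> in \<open>auto simp: P_def\<close>)
    next
      case False
      then have "k \<in> B \<inter> {-n..n}"
        using k by (auto simp: B_def)
      then show ?thesis
        using \<open>t \<in> I\<close> \<open>P t d\<close> \<open>P t c\<close> by (intro bexI[of _ "t k"]) (auto simp: P_def I_def)
    qed
    then show ?thesis
      using that by (auto simp: P_def)
  qed
  have "\<exists>D. finite D \<and> (\<forall>d\<in>D. P t d) \<and> fin_join D = fin_join (S t)
    \<and> pairwise (\<lambda>d e. inf d e = bot) D" if t: "t \<in> I" for t
  proof -
    have "finite (S t)"
      using finC by (simp add: S_def)
    then obtain E where "finite E" "\<And>d. d \<in> E \<Longrightarrow> P t d" "fin_join E = fin_join (S t)"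
      "pairwise (\<lambda>d e. inf d e = bot) E"
      by (rule disjoint_joins[of "S t" "P t"]) (use PS P_sup[OF t] in blast)+
    then show ?thesis
      by blast
  qed
  then obtain D where D: "\<And>t. t \<in> I \<Longrightarrow> finite (D t) \<and> (\<forall>d\<in>D t. P t d)
      \<and> fin_join (D t) = fin_join (S t) \<and> pairwise (\<lambda>d e. inf d e = bot) (D t)"
    by metis
  let ?V = "\<Union>t\<in>I. D t"
  have finV: "finite ?V"
    using finI D by auto
  have "c \<le> fin_join ?V" if c: "c \<in> C" for c
  proof -
    \<comment> \<open>Choosing a member of \<open>U\<close> above \<open>c\<close> at each boundary
      time gives a label whose group contains \<open>c\<close>.\<close>
    have "\<forall>k\<in>B \<inter> {-n..n}. \<exists>u. u \<in> U \<and> c \<le> int_iterate f k u"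
    proof
      fix k
      assume "k \<in> B \<inter> {-n..n}"
      then have "\<bar>k\<bar> \<le> n"
        by (auto simp: abs_le_iff)
      then show "\<exists>u. u \<in> U \<and> c \<le> int_iterate f k u"
        using C_le[OF c] by blast
    qed
    then obtain t where t: "\<forall>k\<in>B \<inter> {-n..n}. t k \<in> U \<and> c \<le> int_iterate f k (t k)"
      by metis
    let ?t = "restrict t (B \<inter> {-n..n})"
    have tI: "?t \<in> I"
      using t by (auto simp: I_def)
    have "c \<in> S ?t"
      using t c by (simp add: S_def)
    then have "c \<le> fin_join (S ?t)"
      using finC by (intro fin_join.coboundedI) (auto simp: S_def)
    also have "\<dots> = fin_join (D ?t)"
      using D[OF tI] by simp
    also have "\<dots> \<le> fin_join ?V"
      using D[OF tI] tI finV by (intro fin_join_least_upper_bound(2))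
        (auto intro!: fin_join.coboundedI)
    finally show ?thesis .
  qed
  then have "fin_join ?V = top"
    using fin_join_least_upper_bound(2)[OF finC, of "fin_join ?V"] joinC by (simp add: top_unique)
  then have V: "?V \<in> covers"
    using finV by (simp add: covers_def)
  show thesis
  proof
    show "?V \<in> covers"
      by (rule V)
    show "cover_order ?V \<le> card U ^ (2 * N)"
      using cover_order_UN_le[OF bt finI V] D cardI by fastforce
    show "\<exists>u\<in>U. v \<le> int_iterate f k u" if "v \<in> ?V" "\<bar>k\<bar> \<le> n" for v k
      using that D unfolding P_def by blast
  qed
qed

theorem theorem3p4:
  fixes U :: "'a :: {distrib_lattice, bounded_lattice} set"
    and f :: "'a \<Rightarrow> 'a"
  assumes "(bot :: 'a) \<noteq> top"
    and "U \<in> covers"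
    and "automorphism f"
    and "expansive f"
    and "expansivity_cover f (cover_square U)"
  shows "lattice_dim TYPE('a) \<noteq> \<infinity>"
proof -
  have ne: "cover_square U \<noteq> {}"
    using assms(1,5) by (auto simp: expansivity_cover_def covers_def)
  \<comment> \<open>Expansivity is applied to \<open>U\<close> itself, so \<open>N\<close> is fixed
    before the cover \<open>W\<close> to be refined.\<close>
  obtain N :: nat where
    N: "\<And>x. (\<And>k. \<bar>k\<bar> \<le> int N \<Longrightarrow> \<exists>v\<in>cover_square U. x \<le> int_iterate f k v)
      \<Longrightarrow> \<exists>u\<in>U. x \<le> u"
    using expansivity_coverD[OF assms(5,2)] by blast
  \<comment> \<open>The \<open>+ 1\<close> matches the shift in \<open>dim_le\<close>; the cover
    constructed satisfies the bound without it.\<close>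
  have "\<exists>V\<in>covers. V \<prec> W \<and> cover_order V \<le> card U ^ (2 * N) + 1" if W: "W \<in> covers" for W :: "'a set"
  proof -
    obtain M :: nat where
      M: "\<And>x. (\<And>k. \<bar>k\<bar> \<le> int M \<Longrightarrow> \<exists>v\<in>cover_square U. x \<le> int_iterate f k v)
        \<Longrightarrow> \<exists>w\<in>W. x \<le> w"
      using expansivity_coverD[OF assms(5) W] by blast
    obtain V where V: "V \<in> covers" "cover_order V \<le> card U ^ (2 * N)"
      "\<And>v k. v \<in> V \<Longrightarrow> \<bar>k\<bar> \<le> int M \<Longrightarrow> \<exists>u\<in>U. v \<le> int_iterate f k u"
      using bounded_order_cover[OF assms(1-3) N, where n = "int M"] by blast
    have "\<exists>w\<in>W. v \<le> w" if v: "v \<in> V" for v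
    proof (rule M)
      fix k :: int
      assume "\<bar>k\<bar> \<le> int M"
      then obtain u where u: "u \<in> U" "v \<le> int_iterate f k u"
        using V(3)[OF v] by blast
      \<comment> \<open>\<open>V\<close> is controlled by iterates of \<open>U\<close>, whereas
        \<open>M\<close> asks for iterates of the square.\<close>
      obtain w where "w \<in> cover_square U" "u \<le> w"
        using cover_square_superset[OF u(1) ne] by blast
      then show "\<exists>w\<in>cover_square U. v \<le> int_iterate f k w"
        using u(2) automorphism_le_iff[OF automorphism_int_iterate[OF assms(3)]]
        by (meson order_trans)
    qed
    then have "V \<prec> W"
      by (simp add: refines_def)
    with V show ?thesis
      by (intro bexI[of _ V]) auto
  qed
  then have "dim_le TYPE('a) (card U ^ (2 * N))"
    by (simp add: dim_le_def)
  then show ?thesis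
    by (auto simp: lattice_dim_def)
qed

end
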